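(* Let $R$ be a local ring in which $1_R$ is not the sum of two units, and let $\sigma: R\to R$ be a ring endomorphism. Then the following are equivalent: (1) $T_3(R,\sigma)$ is strongly clean. (2) For every $a\in 1+J(R)$ and $b\in J(R)$, the maps $l_{a}-r_{\sigma(b)}$ and $l_{a}-r_{\sigma^2(b)}$ from $R$ to $R$ are surjective.
   Context: All rings are associative with identity $1$, not necessarily commutative. $J(R)$ denotes the Jacobson radical of $R$. A ring is local if it has exactly one maximal right ideal. A ring endomorphism $\sigma$ of $R$ satisfies $\sigma(1)=1$, and $\sigma^2=\sigma\circ\sigma$. For a ring $R$ and an endomorphism $\sigma$ of $R$, $T_n(R,\sigma)$ is the ring of all $n\times n$ upper triangular matrices over $R$ with entrywise addition and multiplication $(a_{ij})(b_{ij})=(c_{ij})$, where $c_{ij}=\sum_{k=i}^{n}a_{ik}\sigma^{k-i}(b_{kj})$ for $i\le j$. For $a\in R$, $l_a,r_a: R\to R$ are the additive group endomorphisms $l_a(r)=ar$, $r_a(r)=ra$; thus $(l_a-r_b)(r)=ar-rb$. An element $a$ of a ring $S$ is strongly clean if there exist an idempotent $e\in S$ and a unit $u\in S$ with $a=e+u$ and $eu=ue$. A ring is strongly clean if all its elements are strongly clean. *)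

theory Defs
  imports "HOL-Algebra.UnivPoly"
begin

text \<open>
  The ideal theory of HOL-Algebra is two-sided. Over a noncommutative ring, locality and the
  Jacobson radical have to be defined through one-sided ideals.
\<close>

definition right_ideal :: "('a, 'm) ring_scheme \<Rightarrow> 'a set \<Rightarrow> bool" where
  "right_ideal R I \<longleftrightarrow>
     additive_subgroup I R \<and> (\<forall>a\<in>I. \<forall>x\<in>carrier R. a \<otimes>\<^bsub>R\<^esub> x \<in> I)"

definition maximal_right_ideal :: "('a, 'm) ring_scheme \<Rightarrow> 'a set \<Rightarrow> bool" where
  "maximal_right_ideal R I \<longleftrightarrow>
     right_ideal R I \<and> I \<noteq> carrier R \<and>
     (\<forall>J. right_ideal R J \<and> I \<subseteq> J \<longrightarrow> J = I \<or> J = carrier R)"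

definition local_ring :: "('a, 'm) ring_scheme \<Rightarrow> bool" where
  "local_ring R \<longleftrightarrow> ring R \<and> (\<exists>!I. maximal_right_ideal R I)"

definition jacobson_radical :: "('a, 'm) ring_scheme \<Rightarrow> 'a set" where
  "jacobson_radical R = {x \<in> carrier R. \<forall>I. maximal_right_ideal R I \<longrightarrow> x \<in> I}"

definition left_mult :: "('a, 'm) ring_scheme \<Rightarrow> 'a \<Rightarrow> 'a \<Rightarrow> 'a" where
  "left_mult R a = (\<lambda>r. a \<otimes>\<^bsub>R\<^esub> r)"

definition right_mult :: "('a, 'm) ring_scheme \<Rightarrow> 'a \<Rightarrow> 'a \<Rightarrow> 'a" where
  "right_mult R a = (\<lambda>r. r \<otimes>\<^bsub>R\<^esub> a)"

definition strongly_clean_elem :: "('a, 'm) ring_scheme \<Rightarrow> 'a \<Rightarrow> bool" where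
  "strongly_clean_elem S a \<longleftrightarrow>
     (\<exists>e\<in>carrier S. \<exists>u\<in>Units S.
        e \<otimes>\<^bsub>S\<^esub> e = e \<and> a = e \<oplus>\<^bsub>S\<^esub> u \<and> e \<otimes>\<^bsub>S\<^esub> u = u \<otimes>\<^bsub>S\<^esub> e)"

definition strongly_clean :: "('a, 'm) ring_scheme \<Rightarrow> bool" where
  "strongly_clean S \<longleftrightarrow> ring S \<and> (\<forall>a\<in>carrier S. strongly_clean_elem S a)"

text \<open>
  The skew triangular matrix ring \<open>T\<^sub>n(R, \<sigma>)\<close>. A matrix is a function of its row and column
  index, both running over \<open>1, \<dots>, n\<close>. It takes the value zero below the diagonal and outside
  the index range, so that equality of matrices is equality of functions.
\<close>

definition skew_triangular_ring ::
    "nat \<Rightarrow> ('a, 'm) ring_scheme \<Rightarrow> ('a \<Rightarrow> 'a) \<Rightarrow> (nat \<Rightarrow> nat \<Rightarrow> 'a) ring" where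
  "skew_triangular_ring n R \<sigma> =
     \<lparr> carrier = {A. \<forall>i j. if 1 \<le> i \<and> i \<le> j \<and> j \<le> n then A i j \<in> carrier R
                          else A i j = \<zero>\<^bsub>R\<^esub>},
       mult = (\<lambda>A B i j. if 1 \<le> i \<and> i \<le> j \<and> j \<le> n
                 then (\<Oplus>\<^bsub>R\<^esub>k\<in>{i..n}. A i k \<otimes>\<^bsub>R\<^esub> (\<sigma> ^^ (k - i)) (B k j))
                 else \<zero>\<^bsub>R\<^esub>),
       one = (\<lambda>i j. if 1 \<le> i \<and> i = j \<and> j \<le> n then \<one>\<^bsub>R\<^esub> else \<zero>\<^bsub>R\<^esub>),
       zero = (\<lambda>i j. \<zero>\<^bsub>R\<^esub>),
       add = (\<lambda>A B i j. A i j \<oplus>\<^bsub>R\<^esub> B i j) \<rparr>"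

lemma (in abelian_monoid) finsum_swap:
  assumes "finite A" "finite B" "\<And>a b. a \<in> A \<Longrightarrow> b \<in> B \<Longrightarrow> g a b \<in> carrier G"
  shows "(\<Oplus>a\<in>A. \<Oplus>b\<in>B. g a b) = (\<Oplus>b\<in>B. \<Oplus>a\<in>A. g a b)"
  using assms(1,3)
proof (induction A rule: finite_induct)
  case empty
  then show ?case by simp
next
  case (insert x A)
  have "(\<Oplus>a\<in>insert x A. \<Oplus>b\<in>B. g a b) = (\<Oplus>b\<in>B. g x b) \<oplus> (\<Oplus>b\<in>B. \<Oplus>a\<in>A. g a b)"
    using insert by (simp add: Pi_def finsum_closed)
  also have "\<dots> = (\<Oplus>b\<in>B. g x b \<oplus> (\<Oplus>a\<in>A. g a b))"
    using insert by (simp add: finsum_addf Pi_def finsum_closed)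
  also have "\<dots> = (\<Oplus>b\<in>B. \<Oplus>a\<in>insert x A. g a b)"
    using insert by (intro finsum_cong') (auto simp: Pi_def finsum_closed)
  finally show ?case .
qed

lemma funpow_ring_hom:
  assumes "ring R" "\<sigma> \<in> ring_hom R R"
  shows "\<sigma> ^^ k \<in> ring_hom R R"
proof (induction k)
  case 0
  show ?case by (simp add: ring_hom_def id_def)
next
  case (Suc k)
  show ?case using ring_hom_trans[OF Suc assms(2)] by (simp add: comp_def)
qed

lemma skew_triangular_ring_is_ring:
  assumes R: "ring R" and \<sigma>: "\<sigma> \<in> ring_hom R R"
  shows "ring (skew_triangular_ring n R \<sigma>)"
proof -
  interpret ring R by fact
  interpret H: ring_hom_ring R R "\<sigma> ^^ k" for k
    using funpow_ring_hom[OF R \<sigma>] R by (simp add: ring_hom_ringI2)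
  let ?T = "skew_triangular_ring n R \<sigma>"
  define I where "I i j \<longleftrightarrow> 1 \<le> i \<and> i \<le> j \<and> j \<le> n" for i j :: nat
  have car: "A \<in> carrier ?T \<longleftrightarrow> (\<forall>i j. A i j \<in> carrier R \<and> (\<not> I i j \<longrightarrow> A i j = \<zero>\<^bsub>R\<^esub>))" for A
  proof -
    have "A \<in> carrier ?T \<longleftrightarrow> (\<forall>i j. if I i j then A i j \<in> carrier R else A i j = \<zero>\<^bsub>R\<^esub>)"
      by (simp add: skew_triangular_ring_def I_def)
    then show ?thesis by (metis zero_closed)
  qed
  have cl: "A i j \<in> carrier R" if "A \<in> carrier ?T" for A i j
    using that by (simp add: car)
  have z: "A i j = \<zero>\<^bsub>R\<^esub>" if "A \<in> carrier ?T" "\<not> I i j" for A i j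
    using that by (simp add: car)
  have mul: "(A \<otimes>\<^bsub>?T\<^esub> B) i j =
      (if I i j then (\<Oplus>\<^bsub>R\<^esub>k\<in>{i..n}. A i k \<otimes>\<^bsub>R\<^esub> (\<sigma> ^^ (k - i)) (B k j)) else \<zero>\<^bsub>R\<^esub>)" for A B i j
    by (simp add: skew_triangular_ring_def I_def)
  have one: "\<one>\<^bsub>?T\<^esub> i j = (if 1 \<le> i \<and> i = j \<and> j \<le> n then \<one>\<^bsub>R\<^esub> else \<zero>\<^bsub>R\<^esub>)" for i j
    by (simp add: skew_triangular_ring_def)
  have add: "(A \<oplus>\<^bsub>?T\<^esub> B) i j = A i j \<oplus>\<^bsub>R\<^esub> B i j" for A B i j
    by (simp add: skew_triangular_ring_def)
  have zero: "\<zero>\<^bsub>?T\<^esub> i j = \<zero>\<^bsub>R\<^esub>" for i j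
    by (simp add: skew_triangular_ring_def)
  have mul_cl: "A \<otimes>\<^bsub>?T\<^esub> B \<in> carrier ?T" if "A \<in> carrier ?T" "B \<in> carrier ?T" for A B
    using that by (auto simp: car mul intro!: finsum_closed)
  show ?thesis
  proof (rule ringI)
    show "abelian_group ?T"
    proof (rule abelian_groupI)
      fix A assume A: "A \<in> carrier ?T"
      show "\<exists>B\<in>carrier ?T. B \<oplus>\<^bsub>?T\<^esub> A = \<zero>\<^bsub>?T\<^esub>"
        by (rule bexI[where x = "\<lambda>i j. \<ominus>\<^bsub>R\<^esub> A i j"])
          (use A in \<open>auto simp: car add zero fun_eq_iff l_neg\<close>)
    qed (auto simp: car add zero fun_eq_iff intro: a_assoc a_comm)
  next
    show "Group.monoid ?T"
    proof (rule monoidI)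
      show "\<one>\<^bsub>?T\<^esub> \<in> carrier ?T" by (auto simp: car one I_def)
    next
      fix A assume A: "A \<in> carrier ?T"
      show "\<one>\<^bsub>?T\<^esub> \<otimes>\<^bsub>?T\<^esub> A = A"
      proof (intro ext)
        fix i j
        show "(\<one>\<^bsub>?T\<^esub> \<otimes>\<^bsub>?T\<^esub> A) i j = A i j"
        proof (cases "I i j")
          case True
          have "(\<Oplus>\<^bsub>R\<^esub>k\<in>{i..n}. \<one>\<^bsub>?T\<^esub> i k \<otimes>\<^bsub>R\<^esub> (\<sigma> ^^ (k - i)) (A k j)) =
                (\<Oplus>\<^bsub>R\<^esub>k\<in>{i..n}. if i = k then A k j else \<zero>\<^bsub>R\<^esub>)"
            using True cl[OF A] by (intro finsum_cong') (auto simp: one I_def)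
          also have "\<dots> = A i j"
            using True cl[OF A] by (subst finsum_singleton) (auto simp: I_def)
          finally show ?thesis using True by (simp add: mul)
        qed (simp add: mul z[OF A])
      qed
      show "A \<otimes>\<^bsub>?T\<^esub> \<one>\<^bsub>?T\<^esub> = A"
      proof (intro ext)
        fix i j
        show "(A \<otimes>\<^bsub>?T\<^esub> \<one>\<^bsub>?T\<^esub>) i j = A i j"
        proof (cases "I i j")
          case True
          have "(\<Oplus>\<^bsub>R\<^esub>k\<in>{i..n}. A i k \<otimes>\<^bsub>R\<^esub> (\<sigma> ^^ (k - i)) (\<one>\<^bsub>?T\<^esub> k j)) =
                (\<Oplus>\<^bsub>R\<^esub>k\<in>{i..n}. if j = k then A i k else \<zero>\<^bsub>R\<^esub>)"
            using True cl[OF A] by (intro finsum_cong') (auto simp: one I_def)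
          also have "\<dots> = A i j"
            using True cl[OF A] by (subst finsum_singleton) (auto simp: I_def)
          finally show ?thesis using True by (simp add: mul)
        qed (simp add: mul z[OF A])
      qed
    next
      fix A B C assume A: "A \<in> carrier ?T" and B: "B \<in> carrier ?T" and C: "C \<in> carrier ?T"
      note [simp] = cl[OF A] cl[OF B] cl[OF C]
      show "A \<otimes>\<^bsub>?T\<^esub> B \<otimes>\<^bsub>?T\<^esub> C = A \<otimes>\<^bsub>?T\<^esub> (B \<otimes>\<^bsub>?T\<^esub> C)"
      proof (intro ext)
        fix i j
        show "(A \<otimes>\<^bsub>?T\<^esub> B \<otimes>\<^bsub>?T\<^esub> C) i j = (A \<otimes>\<^bsub>?T\<^esub> (B \<otimes>\<^bsub>?T\<^esub> C)) i j"
        proof (cases "I i j")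
          case True
          let ?t = "\<lambda>l k. A i l \<otimes>\<^bsub>R\<^esub> (\<sigma> ^^ (l - i)) (B l k) \<otimes>\<^bsub>R\<^esub> (\<sigma> ^^ (k - i)) (C k j)"
          have "(A \<otimes>\<^bsub>?T\<^esub> B \<otimes>\<^bsub>?T\<^esub> C) i j = (\<Oplus>\<^bsub>R\<^esub>k\<in>{i..n}. \<Oplus>\<^bsub>R\<^esub>l\<in>{i..n}. ?t l k)"
            unfolding mul using True
            by (simp, intro finsum_cong') (auto simp: I_def finsum_ldistr)
          also have "\<dots> = (\<Oplus>\<^bsub>R\<^esub>l\<in>{i..n}. \<Oplus>\<^bsub>R\<^esub>k\<in>{i..n}. ?t l k)"
            by (rule finsum_swap) auto
          also have "\<dots> = (\<Oplus>\<^bsub>R\<^esub>l\<in>{i..n}. A i l \<otimes>\<^bsub>R\<^esub> (\<sigma> ^^ (l - i)) ((B \<otimes>\<^bsub>?T\<^esub> C) l j))"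
          proof (rule finsum_cong')
            fix l assume l: "l \<in> {i..n}"
            show "(\<Oplus>\<^bsub>R\<^esub>k\<in>{i..n}. ?t l k) = A i l \<otimes>\<^bsub>R\<^esub> (\<sigma> ^^ (l - i)) ((B \<otimes>\<^bsub>?T\<^esub> C) l j)"
            proof (cases "l \<le> j")
              case lj: True
              have "(\<Oplus>\<^bsub>R\<^esub>k\<in>{i..n}. ?t l k) = (\<Oplus>\<^bsub>R\<^esub>k\<in>{l..n}. ?t l k)"
              proof -
                have "?t l k = \<zero>\<^bsub>R\<^esub>" if "k \<notin> {l..n}" for k
                  using z[OF B, of l k] that by (auto simp: I_def)
                then show ?thesis
                  using l by (intro add.finprod_mono_neutral_cong_right) auto
              qed
              also have "\<dots> = (\<Oplus>\<^bsub>R\<^esub>k\<in>{l..n}. A i l \<otimes>\<^bsub>R\<^esub>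
                  (\<sigma> ^^ (l - i)) (B l k \<otimes>\<^bsub>R\<^esub> (\<sigma> ^^ (k - l)) (C k j)))"
              proof (rule finsum_cong')
                fix k assume k: "k \<in> {l..n}"
                have "k - i = (l - i) + (k - l)" using k l by auto
                then show "?t l k = A i l \<otimes>\<^bsub>R\<^esub>
                  (\<sigma> ^^ (l - i)) (B l k \<otimes>\<^bsub>R\<^esub> (\<sigma> ^^ (k - l)) (C k j))"
                  by (simp add: funpow_add m_assoc)
              qed auto
              also have "\<dots> = A i l \<otimes>\<^bsub>R\<^esub>
                  (\<sigma> ^^ (l - i)) (\<Oplus>\<^bsub>R\<^esub>k\<in>{l..n}. B l k \<otimes>\<^bsub>R\<^esub> (\<sigma> ^^ (k - l)) (C k j))"
                by (subst H.hom_finsum) (auto simp: finsum_rdistr o_def)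
              also have "\<dots> = A i l \<otimes>\<^bsub>R\<^esub> (\<sigma> ^^ (l - i)) ((B \<otimes>\<^bsub>?T\<^esub> C) l j)"
                using True lj l by (simp add: mul I_def)
              finally show ?thesis .
            next
              case lj: False
              have "?t l k = \<zero>\<^bsub>R\<^esub>" for k
                using z[OF B, of l k] z[OF C, of k j] lj by (cases "l \<le> k") (auto simp: I_def)
              then show ?thesis using lj by (simp add: mul I_def add.finprod_one_eqI)
            qed
          qed (use cl[OF mul_cl[OF B C]] in auto)
          finally show ?thesis using True by (simp add: mul[of A])
        qed (simp add: mul)
      qed
    qed (use mul_cl in auto)
  next
    fix A B C assume A: "A \<in> carrier ?T" and B: "B \<in> carrier ?T" and C: "C \<in> carrier ?T"
    note [simp] = cl[OF A] cl[OF B] cl[OF C]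
    show "(A \<oplus>\<^bsub>?T\<^esub> B) \<otimes>\<^bsub>?T\<^esub> C = A \<otimes>\<^bsub>?T\<^esub> C \<oplus>\<^bsub>?T\<^esub> B \<otimes>\<^bsub>?T\<^esub> C"
      by (auto simp: fun_eq_iff mul add l_distr finsum_addf Pi_def)
    show "C \<otimes>\<^bsub>?T\<^esub> (A \<oplus>\<^bsub>?T\<^esub> B) = C \<otimes>\<^bsub>?T\<^esub> A \<oplus>\<^bsub>?T\<^esub> C \<otimes>\<^bsub>?T\<^esub> B"
      by (auto simp: fun_eq_iff mul add r_distr finsum_addf Pi_def)
  qed
qed

end

theory Submission
  imports Defs
begin

text \<open>
  A ring element is strongly clean iff it differs by a unit from an idempotent commuting with it.
  Since the unit \<open>1\<close> is not a sum of two units, the residue ring of \<open>R\<close> is the field with two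
  elements, so the diagonal of such an idempotent matrix \<open>E\<close> for a triangular matrix \<open>A\<close> is forced:
  it is \<open>1\<close> where the diagonal entry of \<open>A\<close> lies in the radical, and \<open>0\<close> elsewhere. The remaining
  entries of \<open>E\<close> are then solutions of equations \<open>a x - x \<tau>(b) = c\<close> with \<open>\<tau> \<in> {\<sigma>, \<sigma>\<^sup>2}\<close>,
  where exactly one of \<open>a\<close>, \<open>b\<close> lies in the radical; the substitution \<open>a \<mapsto> 1 - a\<close>,
  \<open>b \<mapsto> 1 - b\<close> exchanges the two possibilities.
\<close>

section \<open>Local rings\<close>

lemma (in ring) right_ideal_iff:
  "right_ideal R I \<longleftrightarrow> I \<subseteq> carrier R \<and> \<zero> \<in> I \<and> (\<forall>a\<in>I. \<forall>b\<in>I. a \<oplus> b \<in> I)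
     \<and> (\<forall>a\<in>I. \<forall>x\<in>carrier R. a \<otimes> x \<in> I)"
proof
  assume "right_ideal R I"
  then have I: "additive_subgroup I R" "\<forall>a\<in>I. \<forall>x\<in>carrier R. a \<otimes> x \<in> I"
    by (auto simp: right_ideal_def)
  interpret I: additive_subgroup I R by fact
  show "I \<subseteq> carrier R \<and> \<zero> \<in> I \<and> (\<forall>a\<in>I. \<forall>b\<in>I. a \<oplus> b \<in> I)
     \<and> (\<forall>a\<in>I. \<forall>x\<in>carrier R. a \<otimes> x \<in> I)"
    using I(2) I.a_subset I.zero_closed I.a_closed by auto
next
  assume I: "I \<subseteq> carrier R \<and> \<zero> \<in> I \<and> (\<forall>a\<in>I. \<forall>b\<in>I. a \<oplus> b \<in> I)
     \<and> (\<forall>a\<in>I. \<forall>x\<in>carrier R. a \<otimes> x \<in> I)"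
  have "subgroup I (add_monoid R)"
  proof (rule add.subgroupI)
    fix a assume a: "a \<in> I"
    \<comment> \<open>Additive inverses come for free from right multiplication by
      \<open>\<ominus> \<one>\<close>.\<close>
    then have "a \<otimes> (\<ominus> \<one>) \<in> I" and "a \<in> carrier R" using I by auto
    then show "\<ominus> a \<in> I" by (simp add: r_minus)
  qed (use I in auto)
  then show "right_ideal R I"
    using I by (auto simp: right_ideal_def intro: additive_subgroup.intro)
qed

lemma (in ring) right_ideal_eq_carrier:
  assumes "right_ideal R I" "\<one> \<in> I"
  shows "I = carrier R"
proof
  show "carrier R \<subseteq> I"
  proof
    fix x assume x: "x \<in> carrier R"
    then have "\<one> \<otimes> x \<in> I" using assms unfolding right_ideal_iff by blast
    then show "x \<in> I" using x by simp
  qed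
qed (use assms in \<open>simp add: right_ideal_iff\<close>)

text \<open>Zorn's lemma applies to the right ideals that contain \<open>I\<close> and omit
  \<open>\<one>\<close>: omitting \<open>\<one>\<close> expresses properness and passes to unions of
  chains.\<close>

lemma (in ring) ex_maximal_right_ideal:
  assumes I: "right_ideal R I" "\<one> \<notin> I"
  obtains M where "maximal_right_ideal R M" "I \<subseteq> M"
proof -
  let ?P = "{K. right_ideal R K \<and> I \<subseteq> K \<and> \<one> \<notin> K}"
  have "\<exists>M\<in>?P. \<forall>X\<in>?P. M \<subseteq> X \<longrightarrow> X = M"
  proof (rule subset_Zorn_nonempty)
    show "?P \<noteq> {}" using I by auto
  next
    fix C assume C: "C \<noteq> {}" "subset.chain ?P C"
    have ch: "\<forall>K\<in>C. right_ideal R K \<and> I \<subseteq> K \<and> \<one> \<notin> K" "\<forall>X\<in>C. \<forall>Y\<in>C. X \<subseteq> Y \<or> Y \<subseteq> X"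
      using C by (auto simp: subset_chain_def)
    have "a \<oplus> b \<in> \<Union> C" if "a \<in> \<Union> C" "b \<in> \<Union> C" for a b
    proof -
      obtain X Y where XY: "X \<in> C" "Y \<in> C" "a \<in> X" "b \<in> Y"
        using \<open>a \<in> \<Union> C\<close> \<open>b \<in> \<Union> C\<close> by auto
      then obtain Z where Z: "Z \<in> C" "a \<in> Z" "b \<in> Z" using ch(2) by (meson subsetD)
      then have "right_ideal R Z" using ch(1) by simp
      then have "a \<oplus> b \<in> Z" using Z by (simp add: right_ideal_iff)
      then show ?thesis using Z by blast
    qed
    moreover have "a \<otimes> x \<in> \<Union> C" if a: "a \<in> \<Union> C" and x: "x \<in> carrier R" for a x
    proof -
      obtain K where K: "K \<in> C" "a \<in> K" using a by auto
      then have "right_ideal R K" using ch(1) by simp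
      then have "a \<otimes> x \<in> K" using K x by (simp add: right_ideal_iff)
      then show ?thesis using K by blast
    qed
    moreover have "K \<subseteq> carrier R" "\<zero> \<in> K" if "K \<in> C" for K
      using ch(1) that by (simp_all add: right_ideal_iff)
    then have "\<Union> C \<subseteq> carrier R" "\<zero> \<in> \<Union> C"
      using C(1) by blast+
    ultimately have "right_ideal R (\<Union> C)" by (simp add: right_ideal_iff del: Union_iff)
    moreover have "I \<subseteq> \<Union> C"
    proof -
      obtain K where "K \<in> C" using C(1) by auto
      then show ?thesis using ch(1) by blast
    qed
    moreover have "\<one> \<notin> \<Union> C" using ch(1) by auto
    ultimately show "\<Union> C \<in> ?P" by simp
  qed
  then obtain M where M: "M \<in> ?P" "\<forall>X\<in>?P. M \<subseteq> X \<longrightarrow> X = M" by blast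
  have "maximal_right_ideal R M"
    unfolding maximal_right_ideal_def
  proof (intro conjI allI impI)
    fix J assume J: "right_ideal R J \<and> M \<subseteq> J"
    show "J = M \<or> J = carrier R"
      using J M right_ideal_eq_carrier[of J] by (cases "\<one> \<in> J") auto
  qed (use M in auto)
  then show ?thesis using that M by auto
qed

lemma (in ring) Units_a_inv_closed:
  assumes u: "u \<in> Units R"
  shows "\<ominus> u \<in> Units R"
proof -
  have "\<ominus> \<one> \<otimes> u \<in> Units R" using Units_m_closed[OF Units_minus_one_closed u] .
  then show ?thesis using Units_closed[OF u] by (simp add: l_minus)
qed

text \<open>The radical is the unique maximal right ideal \<open>I\<close>. An \<open>x\<close>
  outside \<open>I\<close> has a right inverse, because a proper right ideal \<open>x R\<close>
  would lie in \<open>I\<close>. That right inverse is again outside \<open>I\<close>, so it has a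
  right inverse too, and \<open>x\<close> is a two-sided unit.\<close>

lemma local_ring_jacobson_radical:
  fixes R (structure)
  assumes "local_ring R"
  shows "jacobson_radical R = carrier R - Units R"
    and "right_ideal R (jacobson_radical R)"
proof -
  interpret ring R using assms by (simp add: local_ring_def)
  obtain I where I: "maximal_right_ideal R I" "\<And>K. maximal_right_ideal R K \<Longrightarrow> K = I"
    using assms by (auto simp: local_ring_def)
  have rI: "right_ideal R I" and 1: "\<one> \<notin> I"
    using I(1) right_ideal_eq_carrier[of I] unfolding maximal_right_ideal_def by blast+
  from rI have Ic: "I \<subseteq> carrier R" and I0: "\<zero> \<in> I"
    and Ia: "\<And>a b. a \<in> I \<Longrightarrow> b \<in> I \<Longrightarrow> a \<oplus> b \<in> I"
    and Im: "\<And>a x. a \<in> I \<Longrightarrow> x \<in> carrier R \<Longrightarrow> a \<otimes> x \<in> I"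
    by (auto simp: right_ideal_iff)
  have J: "jacobson_radical R = I"
    using I Ic unfolding jacobson_radical_def by blast
  have rinv: "\<exists>y\<in>carrier R. x \<otimes> y = \<one>" if x: "x \<in> carrier R" "x \<notin> I" for x
  proof (rule ccontr)
    let ?K = "(\<lambda>y. x \<otimes> y) ` carrier R"
    assume "\<not> ?thesis"
    then have "\<one> \<notin> ?K" by auto
    moreover have "right_ideal R ?K"
      unfolding right_ideal_iff
    proof (intro conjI ballI)
      show "?K \<subseteq> carrier R" using x by auto
      show "\<zero> \<in> ?K" using x by (auto intro!: image_eqI[of _ _ \<zero>])
      fix a assume a: "a \<in> ?K"
      show "a \<oplus> b \<in> ?K" if "b \<in> ?K" for b
        using a that x by (auto simp flip: r_distr)
      show "a \<otimes> b \<in> ?K" if "b \<in> carrier R" for b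
        using a that x by (auto simp: m_assoc)
    qed
    ultimately obtain M where "maximal_right_ideal R M" "?K \<subseteq> M"
      using ex_maximal_right_ideal by metis
    then have "?K \<subseteq> I" using I(2) by blast
    moreover have "x \<in> ?K" using x by (auto intro!: image_eqI[of _ _ \<one>])
    ultimately show False using x by auto
  qed
  have unit: "x \<in> Units R" if x: "x \<in> carrier R" "x \<notin> I" for x
  proof -
    obtain y where y: "y \<in> carrier R" "x \<otimes> y = \<one>" using rinv x by auto
    have "y \<notin> I"
    proof
      assume "y \<in> I"
      then have yx: "y \<otimes> x \<in> I" using Im x by auto
      \<comment> \<open>With \<open>y\<close> in \<open>I\<close>, this element has a right inverse.
        But left multiplication by \<open>x\<close> kills it, since
        \<open>x \<otimes> y = \<one>\<close>, and so \<open>x = \<zero>\<close>, which lies in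
        \<open>I\<close>.\<close>
      have "\<one> \<ominus> y \<otimes> x \<notin> I"
      proof
        assume "\<one> \<ominus> y \<otimes> x \<in> I"
        then have "\<one> \<ominus> y \<otimes> x \<oplus> y \<otimes> x \<in> I" using Ia yx by auto
        then show False using 1 x y by (simp add: minus_eq a_assoc l_neg)
      qed
      then obtain w where w: "w \<in> carrier R" "(\<one> \<ominus> y \<otimes> x) \<otimes> w = \<one>"
        using rinv[of "\<one> \<ominus> y \<otimes> x"] x y by auto
      have "x \<otimes> (\<one> \<ominus> y \<otimes> x) = x \<ominus> x \<otimes> y \<otimes> x"
        using x y by (simp add: minus_eq r_distr r_minus m_assoc[symmetric])
      also have "\<dots> = \<zero>" using x y by (simp add: minus_eq r_neg)
      finally have "x = \<zero>" using w x y by (metis l_null m_assoc minus_closed m_closed one_closed r_one)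
      then show False using x I0 by simp
    qed
    then obtain z where z: "z \<in> carrier R" "y \<otimes> z = \<one>" using rinv y by auto
    then have "z = x" using x y by (metis l_one m_assoc r_one)
    then show ?thesis using x y z by (auto simp: Units_def)
  qed
  have "x \<notin> Units R" if "x \<in> I" for x
    using that Im[of x] 1 by (metis Units_inv_closed Units_r_inv)
  then show "jacobson_radical R = carrier R - Units R" using J unit Ic by auto
  show "right_ideal R (jacobson_radical R)" using J rI by simp
qed

section \<open>Local rings whose residue ring has two elements\<close>

locale binary_local_ring = ring R for R (structure) +
  assumes local: "local_ring R"
    and one_not_sum: "\<not> (\<exists>u\<in>Units R. \<exists>v\<in>Units R. \<one> = u \<oplus> v)"
begin

abbreviation J where "J \<equiv> jacobson_radical R"

lemmas J_eq = local_ring_jacobson_radical(1)[OF local]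

lemma J_add: "a \<in> J \<Longrightarrow> b \<in> J \<Longrightarrow> a \<oplus> b \<in> J"
  using local_ring_jacobson_radical(2)[OF local] by (simp add: right_ideal_iff)

lemma J_minus: "a \<in> J \<Longrightarrow> \<ominus> a \<in> J"
  using local_ring_jacobson_radical(2)[OF local]
  by (simp add: right_ideal_def additive_subgroup.a_inv_closed)

text \<open>The two elements sum to \<open>\<one>\<close>. They cannot both lie in \<open>J\<close>,
  which is closed under addition and omits \<open>\<one>\<close>, nor can both be units, by
  \<open>one_not_sum\<close>.\<close>

lemma one_minus_in_J:
  assumes a: "a \<in> carrier R"
  shows "\<one> \<ominus> a \<in> J \<longleftrightarrow> a \<notin> J"
proof -
  have sum: "\<one> = a \<oplus> (\<one> \<ominus> a)"
    using a by (simp add: minus_eq a_lcomm[of a] r_neg)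
  have "\<one> \<notin> J" by (simp add: J_eq)
  then have "\<not> (a \<in> J \<and> \<one> \<ominus> a \<in> J)" using sum J_add by metis
  moreover have "\<not> (a \<notin> J \<and> \<one> \<ominus> a \<notin> J)"
    using sum one_not_sum a by (auto simp: J_eq)
  ultimately show ?thesis by blast
qed

text \<open>For a unit \<open>a\<close>, \<open>one_minus_in_J\<close> puts
  \<open>\<one> \<ominus> a\<close> in \<open>J\<close>; conversely,
  \<open>\<one> \<oplus> h\<close> in \<open>J\<close> would put \<open>\<one>\<close> there. Thus
  the coset in the theorem ranges over exactly the units.\<close>

lemma coset_J: "\<one> <+ J = carrier R - J"
proof -
  have "a \<in> carrier R - J" if a: "a \<in> \<one> <+ J" for a
  proof -
    obtain h where h: "h \<in> J" "a = \<one> \<oplus> h"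
      using a by (auto simp: a_l_coset_def l_coset_def)
    have hc: "h \<in> carrier R" using h by (simp add: J_eq)
    have "a \<in> J \<Longrightarrow> False"
    proof -
      assume "a \<in> J"
      then have "a \<oplus> \<ominus> h \<in> J" using J_minus[OF h(1)] by (rule J_add)
      then show False using h hc by (simp add: a_assoc r_neg J_eq)
    qed
    then show ?thesis using h hc by auto
  qed
  moreover have "a \<in> \<one> <+ J" if "a \<in> carrier R - J" for a
  proof -
    have "\<ominus> (\<one> \<ominus> a) \<in> J"
      using one_minus_in_J[of a] J_minus that by simp
    moreover have "a = \<one> \<oplus> \<ominus> (\<one> \<ominus> a)"
      using that by (simp add: minus_eq minus_add r_neg2)
    ultimately show ?thesis unfolding a_l_coset_def l_coset_def by auto
  qed
  ultimately show ?thesis by blast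
qed

definition idem_part :: "'a \<Rightarrow> 'a" where
  "idem_part a = (if a \<in> J then \<one> else \<zero>)"

lemma idem_part_closed [simp]: "idem_part a \<in> carrier R"
  by (simp add: idem_part_def)

lemma idem_part_idem: "idem_part a \<otimes> idem_part a = idem_part a"
  by (simp add: idem_part_def)

lemma idem_part_comm: "a \<in> carrier R \<Longrightarrow> a \<otimes> idem_part b = idem_part b \<otimes> a"
  by (simp add: idem_part_def)

lemma minus_idem_part_unit:
  assumes a: "a \<in> carrier R"
  shows "a \<ominus> idem_part a \<in> Units R"
proof (cases "a \<in> J")
  case True
  then have "\<one> \<ominus> a \<in> Units R" using one_minus_in_J[OF a] a by (auto simp: J_eq)
  then have "\<ominus> (\<one> \<ominus> a) \<in> Units R" by (rule Units_a_inv_closed)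
  moreover have "\<ominus> (\<one> \<ominus> a) = a \<ominus> \<one>" using a by (simp add: minus_eq minus_add a_comm)
  ultimately show ?thesis using True by (simp add: idem_part_def)
next
  case False
  then show ?thesis using a by (simp add: idem_part_def J_eq minus_eq)
qed

text \<open>Idempotents are trivial: if \<open>e\<close> lies in \<open>J\<close>, the unit
  \<open>\<one> \<ominus> e\<close> cancels from
  \<open>e \<otimes> (\<one> \<ominus> e) = \<zero>\<close>; otherwise the unit \<open>e\<close>
  cancels from \<open>e \<otimes> e = e\<close>. The condition on \<open>a \<ominus> e\<close> then
  decides between \<open>\<zero>\<close> and \<open>\<one>\<close>.\<close>

lemma idem_part_unique:
  assumes e: "e \<in> carrier R" "e \<otimes> e = e" and a: "a \<in> carrier R" and u: "a \<ominus> e \<in> Units R"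
  shows "e = idem_part a"
proof (cases "e \<in> J")
  case True
  then have "\<one> \<ominus> e \<in> Units R" using one_minus_in_J e by (auto simp: J_eq)
  moreover have "e \<otimes> (\<one> \<ominus> e) = \<zero> \<otimes> (\<one> \<ominus> e)"
    using e by (simp add: minus_eq r_distr r_minus r_neg)
  ultimately have "e = \<zero>" using e by (metis Units_closed m_assoc Units_r_inv Units_inv_closed r_one zero_closed)
  then show ?thesis using u a by (simp add: idem_part_def J_eq minus_eq)
next
  case False
  then have "e \<in> Units R" using e by (simp add: J_eq)
  then have "e = \<one>" using e by (metis Units_l_cancel one_closed r_one)
  moreover have "a \<in> J"
  proof (rule ccontr)
    assume "a \<notin> J"
    then have au: "a \<in> Units R" using a by (simp add: J_eq)
    \<comment> \<open>With \<open>a\<close> a unit, \<open>\<one>\<close> would be the sum of the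
      units \<open>a\<close> and \<open>\<one> \<ominus> a\<close>.\<close>
    have "\<ominus> (a \<ominus> \<one>) \<in> Units R" using u \<open>e = \<one>\<close> Units_a_inv_closed by simp
    moreover have "\<one> = a \<oplus> \<ominus> (a \<ominus> \<one>)"
      using a by (simp add: minus_eq minus_add r_neg2)
    ultimately show False using one_not_sum au by blast
  qed
  ultimately show ?thesis by (simp add: idem_part_def)
qed

end

section \<open>Strong cleanness through commuting idempotents\<close>

text \<open>The unit must be \<open>a \<ominus> e\<close>, and \<open>e\<close> commutes with it
  exactly when it commutes with \<open>a\<close>. This leaves the idempotent as the only
  unknown.\<close>

lemma (in ring) strongly_clean_elem_iff:
  assumes a: "a \<in> carrier R"
  shows "strongly_clean_elem R a \<longleftrightarrow>
    (\<exists>e\<in>carrier R. e \<otimes> e = e \<and> e \<otimes> a = a \<otimes> e \<and> a \<ominus> e \<in> Units R)"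
proof
  assume "strongly_clean_elem R a"
  then obtain e u where e: "e \<in> carrier R" "u \<in> Units R" "e \<otimes> e = e" "a = e \<oplus> u" "e \<otimes> u = u \<otimes> e"
    by (auto simp: strongly_clean_elem_def)
  then have u: "u \<in> carrier R" by auto
  have "a \<ominus> e = u" using e u by (simp add: minus_eq a_comm[of e] a_assoc r_neg)
  moreover have "e \<otimes> a = a \<otimes> e" using e u by (simp add: r_distr l_distr)
  ultimately show "\<exists>e\<in>carrier R. e \<otimes> e = e \<and> e \<otimes> a = a \<otimes> e \<and> a \<ominus> e \<in> Units R"
    using e by metis
next
  assume "\<exists>e\<in>carrier R. e \<otimes> e = e \<and> e \<otimes> a = a \<otimes> e \<and> a \<ominus> e \<in> Units R"
  then obtain e where e: "e \<in> carrier R" "e \<otimes> e = e" "e \<otimes> a = a \<otimes> e" "a \<ominus> e \<in> Units R"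
    by blast
  moreover have "a = e \<oplus> (a \<ominus> e)" using a e by (simp add: minus_eq a_lcomm[of e] r_neg)
  moreover have "e \<otimes> (a \<ominus> e) = (a \<ominus> e) \<otimes> e"
    using a e by (simp add: minus_eq r_distr l_distr r_minus l_minus)
  ultimately show "strongly_clean_elem R a" unfolding strongly_clean_elem_def by blast
qed

section \<open>Skew triangular matrices of size three\<close>

locale ring_endomorphism = ring R for R (structure) +
  fixes \<sigma> :: "'a \<Rightarrow> 'a"
  assumes endo: "\<sigma> \<in> ring_hom R R"
begin

sublocale H: ring_hom_ring R R \<sigma>
  using endo ring_axioms by (simp add: ring_hom_ringI2)

abbreviation T3 where "T3 \<equiv> skew_triangular_ring 3 R \<sigma>"

sublocale T3: ring T3
  using skew_triangular_ring_is_ring[OF ring_axioms endo] .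

text \<open>The matrix with diagonal \<open>a\<close>, \<open>b\<close>, \<open>c\<close>, superdiagonal \<open>x\<close>, \<open>y\<close> and corner entry \<open>z\<close>.\<close>

definition tri :: "'a \<Rightarrow> 'a \<Rightarrow> 'a \<Rightarrow> 'a \<Rightarrow> 'a \<Rightarrow> 'a \<Rightarrow> nat \<Rightarrow> nat \<Rightarrow> 'a" where
  "tri a b c x y z = (\<lambda>i j.
     if i = 1 \<and> j = 1 then a else if i = 2 \<and> j = 2 then b else if i = 3 \<and> j = 3 then c else
     if i = 1 \<and> j = 2 then x else if i = 2 \<and> j = 3 then y else if i = 1 \<and> j = 3 then z else \<zero>)"

lemma tri_inject:
  "tri a b c x y z = tri a' b' c' x' y' z' \<longleftrightarrow>
     a = a' \<and> b = b' \<and> c = c' \<and> x = x' \<and> y = y' \<and> z = z'" (is "?l = ?r")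
proof
  assume ?l
  then have "tri a b c x y z i j = tri a' b' c' x' y' z' i j" for i j by simp
  from this[of 1 1] this[of 2 2] this[of 3 3] this[of 1 2] this[of 2 3] this[of 1 3]
  show ?r by (simp add: tri_def)
qed simp

text \<open>Splits the index range into the six positions that \<open>tri\<close> distinguishes, so
  that entrywise claims reduce to six concrete computations.\<close>

lemma triangle_cases:
  "(1 \<le> i \<and> i \<le> j \<and> j \<le> 3) \<longleftrightarrow>
     i = 1 \<and> j = 1 \<or> i = 2 \<and> j = 2 \<or> i = 3 \<and> j = 3 \<or>
     i = 1 \<and> j = 2 \<or> i = 2 \<and> j = 3 \<or> i = 1 \<and> j = (3::nat)"
  by presburger

lemma tri_closed [simp]:
  "tri a b c x y z \<in> carrier T3 \<longleftrightarrow> a \<in> carrier R \<and> b \<in> carrier R \<and> c \<in> carrier R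
     \<and> x \<in> carrier R \<and> y \<in> carrier R \<and> z \<in> carrier R" (is "?l = ?r")
proof
  assume ?l
  then have "if 1 \<le> i \<and> i \<le> j \<and> j \<le> 3 then tri a b c x y z i j \<in> carrier R
     else tri a b c x y z i j = \<zero>" for i j
    by (auto simp: skew_triangular_ring_def)
  from this[of 1 1] this[of 2 2] this[of 3 3] this[of 1 2] this[of 2 3] this[of 1 3]
  show ?r by (simp add: tri_def)
next
  assume ?r
  then show ?l
    unfolding skew_triangular_ring_def triangle_cases by (auto simp: tri_def)
qed

lemma tri_cases:
  assumes "A \<in> carrier T3"
  obtains a b c x y z where "A = tri a b c x y z"
    "a \<in> carrier R" "b \<in> carrier R" "c \<in> carrier R"
    "x \<in> carrier R" "y \<in> carrier R" "z \<in> carrier R"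
proof -
  have A: "if 1 \<le> i \<and> i \<le> j \<and> j \<le> 3 then A i j \<in> carrier R else A i j = \<zero>" for i j
    using assms by (auto simp: skew_triangular_ring_def)
  have "A i j = tri (A 1 1) (A 2 2) (A 3 3) (A 1 2) (A 2 3) (A 1 3) i j" for i j
    using A[of i j] unfolding triangle_cases by (simp add: tri_def split: if_splits)
  then have eq: "A = tri (A 1 1) (A 2 2) (A 3 3) (A 1 2) (A 2 3) (A 1 3)"
    by (intro ext)
  show ?thesis
    using that[OF eq] eq assms tri_closed by metis
qed

text \<open>The twist is \<open>\<sigma>\<close> to the distance from the row to the summation
  index. Diagonal products are therefore untwisted, and \<open>\<sigma> (\<sigma> c')\<close>
  appears only in the corner, where the index moves from 1 to 3.\<close>

lemma tri_mult:
  assumes "a \<in> carrier R" "b \<in> carrier R" "c \<in> carrier R"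
    "x \<in> carrier R" "y \<in> carrier R" "z \<in> carrier R"
    "a' \<in> carrier R" "b' \<in> carrier R" "c' \<in> carrier R"
    "x' \<in> carrier R" "y' \<in> carrier R" "z' \<in> carrier R"
  shows "tri a b c x y z \<otimes>\<^bsub>T3\<^esub> tri a' b' c' x' y' z' =
    tri (a \<otimes> a') (b \<otimes> b') (c \<otimes> c') (a \<otimes> x' \<oplus> x \<otimes> \<sigma> b') (b \<otimes> y' \<oplus> y \<otimes> \<sigma> c')
      (a \<otimes> z' \<oplus> (x \<otimes> \<sigma> y' \<oplus> z \<otimes> \<sigma> (\<sigma> c')))"
proof (intro ext)
  fix i j :: nat
  \<comment> \<open>The range starting at 1 is listed in two forms because the simplifier rewrites 1
    to \<open>Suc 0\<close>.\<close>
  have s: "{1..3::nat} = {1,2,3}" "{Suc 0..3} = {1,2,3}" "{2..3::nat} = {2,3}" "\<sigma> ^^ 2 = \<sigma> \<circ> \<sigma>"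
    by (auto simp: numeral_2_eq_2)
  show "(tri a b c x y z \<otimes>\<^bsub>T3\<^esub> tri a' b' c' x' y' z') i j =
    tri (a \<otimes> a') (b \<otimes> b') (c \<otimes> c') (a \<otimes> x' \<oplus> x \<otimes> \<sigma> b') (b \<otimes> y' \<oplus> y \<otimes> \<sigma> c')
      (a \<otimes> z' \<oplus> (x \<otimes> \<sigma> y' \<oplus> z \<otimes> \<sigma> (\<sigma> c'))) i j"
  proof (cases "1 \<le> i \<and> i \<le> j \<and> j \<le> 3")
    case True
    then show ?thesis
      unfolding triangle_cases
      by (elim disjE) (simp_all add: skew_triangular_ring_def tri_def s assms)
  next
    case False
    then have "tri p q r s t u i j = \<zero>" for p q r s t u
      unfolding triangle_cases by (auto simp: tri_def)
    then show ?thesis using False by (auto simp: skew_triangular_ring_def)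
  qed
qed

lemma tri_one: "\<one>\<^bsub>T3\<^esub> = tri \<one> \<one> \<one> \<zero> \<zero> \<zero>"
proof (intro ext)
  fix i j :: nat
  have "(1 \<le> i \<and> i = j \<and> j \<le> 3) \<longleftrightarrow> i = 1 \<and> j = 1 \<or> i = 2 \<and> j = 2 \<or> i = 3 \<and> j = 3"
    by presburger
  then show "\<one>\<^bsub>T3\<^esub> i j = tri \<one> \<one> \<one> \<zero> \<zero> \<zero> i j"
    by (auto simp: skew_triangular_ring_def tri_def)
qed

lemma tri_add:
  "tri a b c x y z \<oplus>\<^bsub>T3\<^esub> tri a' b' c' x' y' z' =
    tri (a \<oplus> a') (b \<oplus> b') (c \<oplus> c') (x \<oplus> x') (y \<oplus> y') (z \<oplus> z')"
  by (auto simp: skew_triangular_ring_def tri_def fun_eq_iff)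

lemma tri_minus:
  assumes "a \<in> carrier R" "b \<in> carrier R" "c \<in> carrier R"
    "x \<in> carrier R" "y \<in> carrier R" "z \<in> carrier R"
    "a' \<in> carrier R" "b' \<in> carrier R" "c' \<in> carrier R"
    "x' \<in> carrier R" "y' \<in> carrier R" "z' \<in> carrier R"
  shows "tri a b c x y z \<ominus>\<^bsub>T3\<^esub> tri a' b' c' x' y' z' =
    tri (a \<ominus> a') (b \<ominus> b') (c \<ominus> c') (x \<ominus> x') (y \<ominus> y') (z \<ominus> z')"
proof -
  have "\<zero>\<^bsub>T3\<^esub> = tri \<zero> \<zero> \<zero> \<zero> \<zero> \<zero>"
    by (auto simp: skew_triangular_ring_def tri_def fun_eq_iff)
  then have "\<ominus>\<^bsub>T3\<^esub> tri a' b' c' x' y' z' =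
      tri (\<ominus> a') (\<ominus> b') (\<ominus> c') (\<ominus> x') (\<ominus> y') (\<ominus> z')"
    using assms by (intro T3.minus_equality) (auto simp: tri_add l_neg)
  then show ?thesis by (simp add: T3.minus_eq minus_eq tri_add)
qed

section \<open>Units of the matrix ring\<close>

text \<open>The equations are solved one at a time by dividing on the left by a diagonal unit: first
  the superdiagonal, then the corner, whose equation involves \<open>y'\<close>.\<close>

lemma tri_right_inverse:
  assumes "a \<in> Units R" "b \<in> Units R" "c \<in> Units R"
    "x \<in> carrier R" "y \<in> carrier R" "z \<in> carrier R"
  obtains x' y' z' where "x' \<in> carrier R" "y' \<in> carrier R" "z' \<in> carrier R"
    "tri a b c x y z \<otimes>\<^bsub>T3\<^esub> tri (inv a) (inv b) (inv c) x' y' z' = \<one>\<^bsub>T3\<^esub>"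
proof -
  have solve: "a \<otimes> (inv a \<otimes> \<ominus> w) \<oplus> w = \<zero>" if "a \<in> Units R" "w \<in> carrier R" for a w
    using that Units_closed[of a] by (simp add: l_neg flip: m_assoc)
  have [simp]: "a \<in> carrier R" "b \<in> carrier R" "c \<in> carrier R" using assms Units_closed by auto
  define x' where "x' = inv a \<otimes> \<ominus> (x \<otimes> \<sigma> (inv b))"
  define y' where "y' = inv b \<otimes> \<ominus> (y \<otimes> \<sigma> (inv c))"
  define z' where "z' = inv a \<otimes> \<ominus> (x \<otimes> \<sigma> y' \<oplus> z \<otimes> \<sigma> (\<sigma> (inv c)))"
  have "x' \<in> carrier R" and y': "y' \<in> carrier R" and "z' \<in> carrier R"
    using assms by (auto simp: x'_def y'_def z'_def)
  moreover have "a \<otimes> x' \<oplus> x \<otimes> \<sigma> (inv b) = \<zero>" "b \<otimes> y' \<oplus> y \<otimes> \<sigma> (inv c) = \<zero>"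
    "a \<otimes> z' \<oplus> (x \<otimes> \<sigma> y' \<oplus> z \<otimes> \<sigma> (\<sigma> (inv c))) = \<zero>"
    unfolding x'_def z'_def using assms y' by (simp_all add: solve y'_def)
  ultimately show ?thesis
    using that[of x' y' z'] assms by (simp add: tri_mult tri_one)
qed

text \<open>Diagonals multiply entrywise, so both products with an inverse give two-sided inverses
  of \<open>a\<close>, \<open>b\<close>, \<open>c\<close>. Conversely, the right inverse
  \<open>?B\<close> has a unit diagonal and so a right inverse \<open>C\<close> of its own;
  associativity gives \<open>C = ?A\<close>.\<close>

lemma tri_Units:
  assumes "a \<in> carrier R" "b \<in> carrier R" "c \<in> carrier R"
    "x \<in> carrier R" "y \<in> carrier R" "z \<in> carrier R"
  shows "tri a b c x y z \<in> Units T3 \<longleftrightarrow> a \<in> Units R \<and> b \<in> Units R \<and> c \<in> Units R"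
proof
  assume "tri a b c x y z \<in> Units T3"
  then obtain B where B: "B \<in> carrier T3" "B \<otimes>\<^bsub>T3\<^esub> tri a b c x y z = \<one>\<^bsub>T3\<^esub>"
    "tri a b c x y z \<otimes>\<^bsub>T3\<^esub> B = \<one>\<^bsub>T3\<^esub>" by (auto simp: Units_def)
  obtain a' b' c' x' y' z' where eq: "B = tri a' b' c' x' y' z'"
    and [simp]: "a' \<in> carrier R" "b' \<in> carrier R" "c' \<in> carrier R"
    "x' \<in> carrier R" "y' \<in> carrier R" "z' \<in> carrier R"
    using B(1) by (rule tri_cases)
  show "a \<in> Units R \<and> b \<in> Units R \<and> c \<in> Units R"
    using B(2,3) assms by (auto simp: eq tri_mult tri_one tri_inject Units_def)
next
  assume u: "a \<in> Units R \<and> b \<in> Units R \<and> c \<in> Units R"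
  let ?A = "tri a b c x y z"
  obtain x' y' z' where v: "x' \<in> carrier R" "y' \<in> carrier R" "z' \<in> carrier R"
    and r: "?A \<otimes>\<^bsub>T3\<^esub> tri (inv a) (inv b) (inv c) x' y' z' = \<one>\<^bsub>T3\<^esub>"
    using u assms tri_right_inverse by metis
  let ?B = "tri (inv a) (inv b) (inv c) x' y' z'"
  obtain C where C: "C \<in> carrier T3" "?B \<otimes>\<^bsub>T3\<^esub> C = \<one>\<^bsub>T3\<^esub>"
    using u v tri_right_inverse[of "inv a" "inv b" "inv c" x' y' z']
    by (metis Units_closed Units_inv_Units Units_inv_inv tri_closed)
  have A: "?A \<in> carrier T3" and B: "?B \<in> carrier T3" using u v assms by auto
  have "C = ?A" using A B C r by (metis T3.l_one T3.m_assoc T3.r_one)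
  then show "?A \<in> Units T3" using A B C r by (auto simp: Units_def)
qed

end

section \<open>The equations for the idempotent\<close>

locale binary_local_endomorphism = binary_local_ring + ring_endomorphism
begin

text \<open>Comparing entries in \<open>E\<^sup>2 = E\<close> and in \<open>A E = E A\<close>.\<close>

lemma strongly_clean_tri:
  assumes [simp]: "a \<in> carrier R" "b \<in> carrier R" "c \<in> carrier R"
    "x \<in> carrier R" "y \<in> carrier R" "z \<in> carrier R"
  shows "strongly_clean_elem T3 (tri a b c x y z) \<longleftrightarrow>
    (\<exists>p\<in>carrier R. \<exists>q\<in>carrier R. \<exists>r\<in>carrier R.
       idem_part a \<otimes> p \<oplus> p \<otimes> idem_part b = p \<and>
       idem_part b \<otimes> q \<oplus> q \<otimes> idem_part c = q \<and>
       idem_part a \<otimes> r \<oplus> (p \<otimes> \<sigma> q \<oplus> r \<otimes> idem_part c) = r \<and>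
       idem_part a \<otimes> x \<oplus> p \<otimes> \<sigma> b = a \<otimes> p \<oplus> x \<otimes> idem_part b \<and>
       idem_part b \<otimes> y \<oplus> q \<otimes> \<sigma> c = b \<otimes> q \<oplus> y \<otimes> idem_part c \<and>
       idem_part a \<otimes> z \<oplus> (p \<otimes> \<sigma> y \<oplus> r \<otimes> \<sigma> (\<sigma> c)) =
         a \<otimes> r \<oplus> (x \<otimes> \<sigma> q \<oplus> z \<otimes> idem_part c))"
    (is "_ = ?rhs")
proof -
  let ?A = "tri a b c x y z"
  \<comment> \<open>The values are only \<open>\<zero>\<close> and \<open>\<one>\<close>, which
    \<open>\<sigma>\<close> fixes; hence no twist remains on the diagonal of the idempotent.\<close>
  have \<sigma>_idem [simp]: "\<sigma> (idem_part d) = idem_part d" for d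
    by (simp add: idem_part_def)
  have A: "?A \<in> carrier T3" by simp
  show ?thesis
  proof
    assume "strongly_clean_elem T3 ?A"
    then obtain E where E: "E \<in> carrier T3" "E \<otimes>\<^bsub>T3\<^esub> E = E" "E \<otimes>\<^bsub>T3\<^esub> ?A = ?A \<otimes>\<^bsub>T3\<^esub> E"
      "?A \<ominus>\<^bsub>T3\<^esub> E \<in> Units T3"
      using T3.strongly_clean_elem_iff[OF A] by blast
    obtain e f g p q r where eq: "E = tri e f g p q r"
      and [simp]: "e \<in> carrier R" "f \<in> carrier R" "g \<in> carrier R"
      "p \<in> carrier R" "q \<in> carrier R" "r \<in> carrier R"
      using E(1) by (rule tri_cases)
    have d: "e \<otimes> e = e" "f \<otimes> f = f" "g \<otimes> g = g"
      using E(2) by (simp_all add: eq tri_mult tri_inject)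
    have u: "a \<ominus> e \<in> Units R" "b \<ominus> f \<in> Units R" "c \<ominus> g \<in> Units R"
      using E(4) by (simp_all add: eq tri_minus tri_Units)
    have "e = idem_part a" "f = idem_part b" "g = idem_part c"
      using d u by (simp_all add: idem_part_unique)
    then show ?rhs
      using E(2,3) unfolding eq
      by (intro bexI[of _ p] bexI[of _ q] bexI[of _ r]) (auto simp: tri_mult tri_inject)
  next
    assume ?rhs
    then obtain p q r where [simp]: "p \<in> carrier R" "q \<in> carrier R" "r \<in> carrier R" and
      eqs: "idem_part a \<otimes> p \<oplus> p \<otimes> idem_part b = p"
       "idem_part b \<otimes> q \<oplus> q \<otimes> idem_part c = q"
       "idem_part a \<otimes> r \<oplus> (p \<otimes> \<sigma> q \<oplus> r \<otimes> idem_part c) = r"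
       "idem_part a \<otimes> x \<oplus> p \<otimes> \<sigma> b = a \<otimes> p \<oplus> x \<otimes> idem_part b"
       "idem_part b \<otimes> y \<oplus> q \<otimes> \<sigma> c = b \<otimes> q \<oplus> y \<otimes> idem_part c"
       "idem_part a \<otimes> z \<oplus> (p \<otimes> \<sigma> y \<oplus> r \<otimes> \<sigma> (\<sigma> c)) =
         a \<otimes> r \<oplus> (x \<otimes> \<sigma> q \<oplus> z \<otimes> idem_part c)"
      by blast
    let ?E = "tri (idem_part a) (idem_part b) (idem_part c) p q r"
    have "?E \<otimes>\<^bsub>T3\<^esub> ?E = ?E" "?E \<otimes>\<^bsub>T3\<^esub> ?A = ?A \<otimes>\<^bsub>T3\<^esub> ?E"
      using eqs by (simp_all add: tri_mult idem_part_idem idem_part_comm)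
    moreover have "?A \<ominus>\<^bsub>T3\<^esub> ?E \<in> Units T3"
      by (simp add: tri_minus tri_Units minus_idem_part_unit)
    ultimately show "strongly_clean_elem T3 ?A"
      using T3.strongly_clean_elem_iff[OF A] by auto
  qed
qed

section \<open>Solving \<open>a x - x \<tau>(b) = c\<close> and filling in the idempotent\<close>

text \<open>The hypothesis \<open>surj\<close> treats only a unit \<open>a\<close> with
  \<open>b\<close> in \<open>J\<close>. In the opposite case it applies to
  \<open>\<one> \<ominus> a\<close> and \<open>\<one> \<ominus> b\<close>. The map
  \<open>\<tau>\<close> will be \<open>\<sigma>\<close> or its square.\<close>

lemma sylvester_solvable:
  assumes \<tau>: "\<tau> \<in> ring_hom R R"
    and surj: "\<And>a b. a \<in> carrier R - J \<Longrightarrow> b \<in> J \<Longrightarrow>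
      (\<lambda>r. left_mult R a r \<ominus> right_mult R (\<tau> b) r) ` carrier R = carrier R"
    and a: "a \<in> carrier R" and b: "b \<in> carrier R" and ab: "(a \<in> J) \<noteq> (b \<in> J)"
    and c: "c \<in> carrier R"
  obtains x where "x \<in> carrier R" "a \<otimes> x = x \<otimes> \<tau> b \<oplus> c"
proof -
  interpret t: ring_hom_ring R R \<tau> using \<tau> ring_axioms by (simp add: ring_hom_ringI2)
  have solve: "\<exists>x\<in>carrier R. a \<otimes> x = x \<otimes> \<tau> b \<oplus> c"
    if a: "a \<in> carrier R - J" and b: "b \<in> J" and c: "c \<in> carrier R" for a b c
  proof -
    have bc: "b \<in> carrier R" using b by (simp add: J_eq)
    obtain x where x: "x \<in> carrier R" "c = a \<otimes> x \<ominus> x \<otimes> \<tau> b"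
      using surj[OF a b] c by (auto simp: left_mult_def right_mult_def)
    have "a \<otimes> x = x \<otimes> \<tau> b \<oplus> c"
      using x(1) a bc by (simp add: x(2) minus_eq a_lcomm[of "x \<otimes> \<tau> b"] r_neg)
    then show ?thesis using x by blast
  qed
  show ?thesis
  proof (cases "a \<in> J")
    case False
    then show ?thesis using solve[of a b c] a b c ab that by blast
  next
    case True
    then have "\<one> \<ominus> a \<in> carrier R - J" "\<one> \<ominus> b \<in> J"
      using one_minus_in_J a b ab by auto
    \<comment> \<open>As \<open>\<tau>\<close> fixes \<open>\<one>\<close>, a summand
      \<open>x\<close> appears on both sides and cancels. What remains is the wanted equation with
      all signs reversed, hence \<open>\<ominus> c\<close>.\<close>
    then obtain x where x: "x \<in> carrier R" "(\<one> \<ominus> a) \<otimes> x = x \<otimes> \<tau> (\<one> \<ominus> b) \<oplus> \<ominus> c"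
      using solve[of "\<one> \<ominus> a" "\<one> \<ominus> b" "\<ominus> c"] c by auto
    then have "x \<oplus> \<ominus> (a \<otimes> x) = x \<oplus> \<ominus> (x \<otimes> \<tau> b \<oplus> c)"
      using a b c by (simp add: minus_eq l_distr r_distr l_minus r_minus minus_add a_assoc)
    then have "\<ominus> (a \<otimes> x) = \<ominus> (x \<otimes> \<tau> b \<oplus> c)" using x(1) a b c by simp
    then have "a \<otimes> x = x \<otimes> \<tau> b \<oplus> c"
      using x(1) a b c by (metis a_closed m_closed minus_minus t.hom_closed)
    then show ?thesis using that x by blast
  qed
qed

text \<open>The superdiagonal entries \<open>p\<close> and \<open>q\<close> are found independently
  through \<open>s1\<close>. The corner \<open>r\<close> then calls for \<open>s2\<close> only when
  exactly one of \<open>a\<close> and \<open>c\<close> lies in \<open>J\<close>.\<close>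

lemma strongly_clean_T3_if_solvable:
  assumes s1: "\<And>a b c. a \<in> carrier R \<Longrightarrow> b \<in> carrier R \<Longrightarrow> c \<in> carrier R \<Longrightarrow> (a \<in> J) \<noteq> (b \<in> J)
      \<Longrightarrow> \<exists>x\<in>carrier R. a \<otimes> x = x \<otimes> \<sigma> b \<oplus> c"
    and s2: "\<And>a b c. a \<in> carrier R \<Longrightarrow> b \<in> carrier R \<Longrightarrow> c \<in> carrier R \<Longrightarrow> (a \<in> J) \<noteq> (b \<in> J)
      \<Longrightarrow> \<exists>x\<in>carrier R. a \<otimes> x = x \<otimes> \<sigma> (\<sigma> b) \<oplus> c"
  shows "strongly_clean T3"
  unfolding strongly_clean_def
proof (intro conjI ballI)
  show "ring T3" by (rule T3.ring_axioms)
  fix A assume "A \<in> carrier T3"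
  then obtain a b c x y z where A: "A = tri a b c x y z"
    and [simp]: "a \<in> carrier R" "b \<in> carrier R" "c \<in> carrier R"
    "x \<in> carrier R" "y \<in> carrier R" "z \<in> carrier R"
    by (rule tri_cases)
  let ?\<epsilon> = idem_part
  have \<epsilon>: "?\<epsilon> d = (if d \<in> J then \<one> else \<zero>)" for d by (simp add: idem_part_def)
  have cancel: "v \<oplus> (u \<oplus> \<ominus> v) = u" if "u \<in> carrier R" "v \<in> carrier R" for u v
    using that by (simp add: a_lcomm[of v] r_neg)
  have ex1: "\<exists>p\<in>carrier R. ?\<epsilon> a \<otimes> p \<oplus> p \<otimes> ?\<epsilon> b = p \<and>
      ?\<epsilon> a \<otimes> x \<oplus> p \<otimes> \<sigma> b = a \<otimes> p \<oplus> x \<otimes> ?\<epsilon> b"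
    if [simp]: "a \<in> carrier R" "b \<in> carrier R" "x \<in> carrier R" for a b x
  proof (cases "(a \<in> J) = (b \<in> J)")
    case True
    then show ?thesis by (auto simp: \<epsilon> intro!: bexI[of _ \<zero>])
  next
    case False
    \<comment> \<open>The idempotent contributes \<open>x\<close> on the left of the commutation
      equation if \<open>a\<close> is in \<open>J\<close>, and on the right if \<open>b\<close> is;
      this fixes the sign.\<close>
    define w where "w = (if a \<in> J then x else \<ominus> x)"
    have "w \<in> carrier R" by (simp add: w_def)
    then obtain p where "p \<in> carrier R" "a \<otimes> p = p \<otimes> \<sigma> b \<oplus> w"
      using s1[of a b w] False by auto
    then show ?thesis using False by (intro bexI[of _ p]) (auto simp: \<epsilon> w_def a_comm r_neg2)
  qed
  obtain p where p [simp]: "p \<in> carrier R" and P: "?\<epsilon> a \<otimes> p \<oplus> p \<otimes> ?\<epsilon> b = p"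
      "?\<epsilon> a \<otimes> x \<oplus> p \<otimes> \<sigma> b = a \<otimes> p \<oplus> x \<otimes> ?\<epsilon> b"
    using ex1[of a b x] by auto
  obtain q where q [simp]: "q \<in> carrier R" and Q: "?\<epsilon> b \<otimes> q \<oplus> q \<otimes> ?\<epsilon> c = q"
      "?\<epsilon> b \<otimes> y \<oplus> q \<otimes> \<sigma> c = b \<otimes> q \<oplus> y \<otimes> ?\<epsilon> c"
    using ex1[of b c y] by auto
  have "\<exists>r\<in>carrier R. ?\<epsilon> a \<otimes> r \<oplus> (p \<otimes> \<sigma> q \<oplus> r \<otimes> ?\<epsilon> c) = r \<and>
      ?\<epsilon> a \<otimes> z \<oplus> (p \<otimes> \<sigma> y \<oplus> r \<otimes> \<sigma> (\<sigma> c)) = a \<otimes> r \<oplus> (x \<otimes> \<sigma> q \<oplus> z \<otimes> ?\<epsilon> c)"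
  proof (cases "(a \<in> J) = (c \<in> J)")
    case False
    \<comment> \<open>Since \<open>a\<close> and \<open>c\<close> differ in membership in
      \<open>J\<close>, \<open>b\<close> agrees with one of them. Where two neighbours agree,
      \<open>P(1)\<close> or \<open>Q(1)\<close> reads \<open>p \<oplus> p = p\<close> or
      \<open>\<zero> = p\<close>, or the same for \<open>q\<close>.\<close>
    have "p = \<zero> \<or> q = \<zero>"
    proof (cases "(a \<in> J) = (b \<in> J)")
      case True
      then have "p = \<zero>" using P(1) p by (auto simp: \<epsilon> split: if_splits)
      then show ?thesis by simp
    next
      case ab: False
      then have "q = \<zero>" using Q(1) q False by (auto simp: \<epsilon> split: if_splits)
      then show ?thesis by simp
    qed
    then have pq: "p \<otimes> \<sigma> q = \<zero>" by auto
    \<comment> \<open>This is the corner equation of \<open>A E = E A\<close> solved for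
      \<open>a \<otimes> r \<ominus> r \<otimes> \<sigma> (\<sigma> c)\<close>.\<close>
    define w where "w = p \<otimes> \<sigma> y \<oplus> ((if a \<in> J then z else \<ominus> z) \<oplus> \<ominus> (x \<otimes> \<sigma> q))"
    have "w \<in> carrier R" by (simp add: w_def)
    then obtain r where r [simp]: "r \<in> carrier R" and R: "a \<otimes> r = r \<otimes> \<sigma> (\<sigma> c) \<oplus> w"
      using s2[of a c w] False by auto
    have R': "a \<otimes> r \<oplus> x \<otimes> \<sigma> q
        = p \<otimes> \<sigma> y \<oplus> r \<otimes> \<sigma> (\<sigma> c) \<oplus> (if a \<in> J then z else \<ominus> z)"
      by (simp add: R w_def a_ac l_neg cancel)
    have "?\<epsilon> a \<otimes> z \<oplus> (p \<otimes> \<sigma> y \<oplus> r \<otimes> \<sigma> (\<sigma> c)) = a \<otimes> r \<oplus> x \<otimes> \<sigma> q \<oplus> z \<otimes> ?\<epsilon> c"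
      unfolding R' using False by (auto simp: \<epsilon> a_comm r_neg2)
    then show ?thesis
      using False by (intro bexI[of _ r]) (auto simp: \<epsilon> pq a_assoc)
  next
    case ac: True
    \<comment> \<open>Here \<open>E\<^sup>2 = E\<close> forces \<open>r = \<plusminus> p \<sigma>(q)\<close>, and the equation for the corner entry is automatic.\<close>
    show ?thesis
    proof (cases "(a \<in> J) = (b \<in> J)")
      case True
      then have "p = \<zero>" "q = \<zero>" using P(1) Q(1) ac by (auto simp: \<epsilon> split: if_splits)
      then show ?thesis using ac by (intro bexI[of _ \<zero>]) (auto simp: \<epsilon>)
    next
      case ab: False
      show ?thesis
      proof (cases "a \<in> J")
        case True
        then have e: "a \<otimes> p = x \<oplus> p \<otimes> \<sigma> b" "q \<otimes> \<sigma> c = b \<otimes> q \<oplus> y"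
          using P(2) Q(2) ac ab by (simp_all add: \<epsilon>)
        define r where "r = \<ominus> (p \<otimes> \<sigma> q)"
        \<comment> \<open>In the corner, \<open>q\<close> occurs only through
          \<open>\<sigma>\<close>, so its equation is pushed through \<open>\<sigma>\<close>. Both
          sides of the corner equation then reduce to
          \<open>z \<ominus> p \<otimes> (\<sigma> b \<otimes> \<sigma> q)\<close>.\<close>
        have "\<sigma> q \<otimes> \<sigma> (\<sigma> c) = \<sigma> b \<otimes> \<sigma> q \<oplus> \<sigma> y"
          using arg_cong[OF e(2), of \<sigma>] by simp
        then have "r \<otimes> \<sigma> (\<sigma> c) = \<ominus> (p \<otimes> (\<sigma> b \<otimes> \<sigma> q) \<oplus> p \<otimes> \<sigma> y)"
          by (simp add: r_def l_minus m_assoc r_distr)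
        moreover have "a \<otimes> r = \<ominus> (x \<otimes> \<sigma> q \<oplus> p \<otimes> (\<sigma> b \<otimes> \<sigma> q))"
          using e(1) by (simp add: r_def r_minus l_distr flip: m_assoc)
        ultimately have "z \<oplus> (p \<otimes> \<sigma> y \<oplus> r \<otimes> \<sigma> (\<sigma> c)) = a \<otimes> r \<oplus> (x \<otimes> \<sigma> q \<oplus> z)"
          by (simp add: minus_add a_ac r_neg2)
        then show ?thesis
          using True ac by (intro bexI[of _ r]) (simp_all add: \<epsilon> r_def r_neg cancel)
      next
        case False
        then have e: "p \<otimes> \<sigma> b = a \<otimes> p \<oplus> x" "y \<oplus> q \<otimes> \<sigma> c = b \<otimes> q"
          using P(2) Q(2) ac ab by (simp_all add: \<epsilon>)
        have "\<sigma> y \<oplus> \<sigma> q \<otimes> \<sigma> (\<sigma> c) = \<sigma> b \<otimes> \<sigma> q"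
          using arg_cong[OF e(2), of \<sigma>] by simp
        then have "p \<otimes> \<sigma> y \<oplus> p \<otimes> \<sigma> q \<otimes> \<sigma> (\<sigma> c) = p \<otimes> \<sigma> b \<otimes> \<sigma> q"
          by (simp add: m_assoc flip: r_distr)
        also have "\<dots> = a \<otimes> (p \<otimes> \<sigma> q) \<oplus> x \<otimes> \<sigma> q"
          by (simp add: e(1) l_distr m_assoc)
        finally show ?thesis
          using False ac by (intro bexI[of _ "p \<otimes> \<sigma> q"]) (simp_all add: \<epsilon>)
      qed
    qed
  qed
  then show "strongly_clean_elem T3 A"
    unfolding A using strongly_clean_tri[of a b c x y z] p P q Q by auto
qed

section \<open>Surjectivity from test matrices\<close>

text \<open>Each test matrix has a single nonzero entry off the diagonal at most, placed so that one
  equation of \<open>strongly_clean_tri\<close> becomes the equation to be solved.\<close>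

lemma solvable_if_strongly_clean_T3:
  assumes T: "strongly_clean T3" and a: "a \<in> carrier R - J" and b: "b \<in> J" and c: "c \<in> carrier R"
  shows "\<exists>x\<in>carrier R. c = a \<otimes> x \<ominus> x \<otimes> \<sigma> b"
    and "\<exists>x\<in>carrier R. c = a \<otimes> x \<ominus> x \<otimes> \<sigma> (\<sigma> b)"
proof -
  have [simp]: "a \<in> carrier R" "b \<in> carrier R" "c \<in> carrier R"
    using a b c by (auto simp: J_eq)
  have \<epsilon> [simp]: "idem_part a = \<zero>" "idem_part b = \<one>" using a b by (auto simp: idem_part_def)
  have move: "c = u \<ominus> v" if "v = u \<oplus> \<ominus> c" "u \<in> carrier R" for u v
    using that by (simp add: minus_eq minus_add r_neg2)
  \<comment> \<open>The (1,2) equation becomes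
    \<open>p \<otimes> \<sigma> b = a \<otimes> p \<oplus> \<ominus> c\<close>, so \<open>p\<close>
    is the solution.\<close>
  have "strongly_clean_elem T3 (tri a b b (\<ominus> c) \<zero> \<zero>)"
    using T by (simp add: strongly_clean_def)
  then show "\<exists>x\<in>carrier R. c = a \<otimes> x \<ominus> x \<otimes> \<sigma> b"
    by (subst (asm) strongly_clean_tri) (auto intro!: move bexI)
  \<comment> \<open>The zero superdiagonal removes \<open>p \<otimes> \<sigma> y\<close> and
    \<open>x \<otimes> \<sigma> q\<close> from the corner equation, which becomes \<open>r \<otimes>
    \<sigma> (\<sigma> b) = a \<otimes> r \<oplus> \<ominus> c\<close>.\<close>
  have "strongly_clean_elem T3 (tri a a b \<zero> \<zero> (\<ominus> c))"
    using T by (simp add: strongly_clean_def)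
  then show "\<exists>x\<in>carrier R. c = a \<otimes> x \<ominus> x \<otimes> \<sigma> (\<sigma> b)"
    by (subst (asm) strongly_clean_tri) (auto intro!: move bexI)
qed

end

theorem corollary4p2:
  fixes R :: "('a, 'm) ring_scheme" (structure)
    and \<sigma> :: "'a \<Rightarrow> 'a"
  assumes "local_ring R"
    and "\<not> (\<exists>u\<in>Units R. \<exists>v\<in>Units R. \<one> = u \<oplus> v)"
    and "\<sigma> \<in> ring_hom R R"
  shows "strongly_clean (skew_triangular_ring 3 R \<sigma>) \<longleftrightarrow>
    (\<forall>a \<in> \<one> <+ jacobson_radical R. \<forall>b \<in> jacobson_radical R.
       (\<lambda>r. left_mult R a r \<ominus> right_mult R (\<sigma> b) r) ` carrier R = carrier R \<and>
       (\<lambda>r. left_mult R a r \<ominus> right_mult R ((\<sigma> \<circ> \<sigma>) b) r) ` carrier R = carrier R)"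
proof -
  interpret ring R using assms(1) by (simp add: local_ring_def)
  interpret binary_local_endomorphism R \<sigma>
    using assms by unfold_locales auto
  show ?thesis (is "_ \<longleftrightarrow> ?surj")
  proof
    assume T: "strongly_clean T3"
    \<comment> \<open>After \<open>coset_J\<close>, \<open>a\<close> is any element outside
      \<open>J\<close>. The images lie in the carrier by closure, and the preimages are the
      solutions just obtained.\<close>
    show ?surj
      using solvable_if_strongly_clean_T3[OF T]
      unfolding coset_J
      by (intro ballI conjI equalityI subsetI) (auto simp: J_eq left_mult_def right_mult_def image_iff)
  next
    assume S: ?surj
    have \<sigma>\<sigma>: "\<sigma> \<circ> \<sigma> \<in> ring_hom R R" using ring_hom_trans[OF endo endo] .
    show "strongly_clean T3"
    proof (rule strongly_clean_T3_if_solvable)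
      fix a b c assume abc: "a \<in> carrier R" "b \<in> carrier R" "c \<in> carrier R" "(a \<in> J) \<noteq> (b \<in> J)"
      show "\<exists>x\<in>carrier R. a \<otimes> x = x \<otimes> \<sigma> b \<oplus> c"
        by (rule sylvester_solvable[OF endo _ abc(1,2,4,3)]) (use S in \<open>auto simp: coset_J\<close>)
      show "\<exists>x\<in>carrier R. a \<otimes> x = x \<otimes> \<sigma> (\<sigma> b) \<oplus> c"
        by (rule sylvester_solvable[OF \<sigma>\<sigma> _ abc(1,2,4,3)]) (use S in \<open>auto simp: coset_J\<close>)
    qed
  qed
qed

end
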